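(* Let $(X,x)$ be a unimodular random graph such that $\mathbb{E}(\deg(x))<+\infty$ and such that there exists a constant $C$ with $$\mathbb{E}\left(\deg(x)\,|S_r(x)|\right)\le C\,\mathbb{E}(|S_r(x)|)$$ for all $r$, where $|S_r(y)|$ denotes the number of vertices at distance exactly $r$ from the vertex $y$ of $X$. Then $$v(X,x)=\liminf_{r\to+\infty}r^{-1}\,\mathbb{E}\left(\log|B_r(x)|\right)<+\infty,$$ where $|B_r(x)|$ is the number of vertices of $X$ at distance $r$ or less from $x$.
   Context: Graphs are connected, locally finite and undirected; multiple edges and loops are allowed, with each loop counted once in the degree. A random (rooted) graph $(X,x)$ is a random element of the space of isomorphism classes of rooted graphs, with the topology in which a sequence converges iff, for each fixed radius, the isomorphism type of the ball of that radius around the root is eventually constant. It is unimodular if for every (measurable) function $F$ from the space of isomorphism classes of graphs with two ordered roots to $[0,+\infty)$ one has $$\mathbb{E}\Big(\sum_{y\in V(X)}F(X,x,y)\Big)=\mathbb{E}\Big(\sum_{y\in V(X)}F(X,y,x)\Big).$$ *)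

theory Defs
  imports "HOL-Probability.Probability"
begin

text \<open>
  A connected locally finite graph is countable, so graphs with vertices in \<open>nat\<close> represent all
  isomorphism classes.  \<open>emult G u v\<close> is the number of edges joining \<open>u\<close> and \<open>v\<close>, and
  \<open>emult G v v\<close> the number of loops at \<open>v\<close>.
\<close>

record multigraph =
  verts :: "nat set"
  emult :: "nat \<Rightarrow> nat \<Rightarrow> nat"

definition adj :: "multigraph \<Rightarrow> (nat \<times> nat) set" where
  "adj G = {(u, v). emult G u v > 0}"

definition lf_graph :: "multigraph \<Rightarrow> bool" where
  "lf_graph G \<longleftrightarrow>
     (\<forall>u v. emult G u v = emult G v u) \<and>
     adj G \<subseteq> verts G \<times> verts G \<and>
     (\<forall>v\<in>verts G. finite {w. emult G v w > 0}) \<and>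
     (\<forall>u\<in>verts G. \<forall>v\<in>verts G. (u, v) \<in> (adj G)\<^sup>*)"

definition deg :: "multigraph \<Rightarrow> nat \<Rightarrow> nat" where
  "deg G v = (\<Sum>w | emult G v w > 0. emult G v w)"

definition gdist :: "multigraph \<Rightarrow> nat \<Rightarrow> nat \<Rightarrow> nat" where
  "gdist G u v = (LEAST n. (u, v) \<in> adj G ^^ n)"

definition gsphere :: "multigraph \<Rightarrow> nat \<Rightarrow> nat \<Rightarrow> nat set" where
  "gsphere G x r = {v \<in> verts G. gdist G x v = r}"

definition gball :: "multigraph \<Rightarrow> nat \<Rightarrow> nat \<Rightarrow> nat set" where
  "gball G x r = {v \<in> verts G. gdist G x v \<le> r}"

definition induced_subgraph :: "multigraph \<Rightarrow> nat set \<Rightarrow> multigraph" where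
  "induced_subgraph G A = \<lparr>verts = verts G \<inter> A,
                  emult = (\<lambda>u v. if u \<in> A \<and> v \<in> A then emult G u v else 0)\<rparr>"

definition graph_iso :: "(nat \<Rightarrow> nat) \<Rightarrow> multigraph \<Rightarrow> multigraph \<Rightarrow> bool" where
  "graph_iso f G H \<longleftrightarrow> bij_betw f (verts G) (verts H) \<and>
     (\<forall>u\<in>verts G. \<forall>v\<in>verts G. emult H (f u) (f v) = emult G u v)"

definition rooted_iso :: "multigraph \<Rightarrow> nat list \<Rightarrow> multigraph \<Rightarrow> nat list \<Rightarrow> bool" where
  "rooted_iso G xs H ys \<longleftrightarrow> (\<exists>f. graph_iso f G H \<and> map f xs = ys)"

text \<open>
  With two roots, the ball is the union of the balls around the roots; for \<open>r\<close> at least the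
  distance of the roots this determines the same topology as the balls around the first root.
\<close>

definition ball_iso :: "nat \<Rightarrow> multigraph \<Rightarrow> nat list \<Rightarrow> multigraph \<Rightarrow> nat list \<Rightarrow> bool" where
  "ball_iso r G xs H ys \<longleftrightarrow>
     rooted_iso (induced_subgraph G (\<Union>x\<in>set xs. gball G x r)) xs (induced_subgraph H (\<Union>y\<in>set ys. gball H y r)) ys"


lemma graph_iso_id: "graph_iso id G G"
  by (simp add: graph_iso_def)

lemma graph_iso_comp:
  "graph_iso f G H \<Longrightarrow> graph_iso g H K \<Longrightarrow> graph_iso (g \<circ> f) G K"
  unfolding graph_iso_def by (auto intro: bij_betw_trans dest: bij_betwE)

lemma graph_iso_inv:
  assumes "graph_iso f G H" shows "graph_iso (inv_into (verts G) f) H G"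
proof -
  have b: "bij_betw f (verts G) (verts H)"
    and m: "\<And>u v. u \<in> verts G \<Longrightarrow> v \<in> verts G \<Longrightarrow> emult H (f u) (f v) = emult G u v"
    using assms by (auto simp: graph_iso_def)
  have "inv_into (verts G) f u \<in> verts G" "f (inv_into (verts G) f u) = u" if "u \<in> verts H" for u
    using that b by (auto simp: bij_betw_def intro: inv_into_into f_inv_into_f)
  then show ?thesis
    unfolding graph_iso_def using bij_betw_inv_into[OF b] m by metis
qed

lemma rooted_iso_refl: "rooted_iso G xs G xs"
  unfolding rooted_iso_def using graph_iso_id by (intro exI[of _ id]) auto

lemma rooted_iso_sym:
  assumes "rooted_iso G xs H ys" "set xs \<subseteq> verts G" shows "rooted_iso H ys G xs"
proof -
  obtain f where f: "graph_iso f G H" "map f xs = ys"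
    using assms by (auto simp: rooted_iso_def)
  have "map (inv_into (verts G) f) ys = xs"
    using f assms(2) unfolding graph_iso_def bij_betw_def
    by (auto simp: o_def intro!: map_idI inv_into_f_f)
  then show ?thesis
    using graph_iso_inv[OF f(1)] by (auto simp: rooted_iso_def)
qed

lemma rooted_iso_trans:
  "rooted_iso G xs H ys \<Longrightarrow> rooted_iso H ys K zs \<Longrightarrow> rooted_iso G xs K zs"
  unfolding rooted_iso_def by (metis graph_iso_comp map_map)

lemma graph_adj_verts: "lf_graph G \<Longrightarrow> (u, v) \<in> adj G \<Longrightarrow> u \<in> verts G \<and> v \<in> verts G"
  by (auto simp: lf_graph_def)

lemma graph_iso_relpow:
  assumes "lf_graph G" "graph_iso f G H" "u \<in> verts G"
  shows "(u, v) \<in> adj G ^^ n \<Longrightarrow> v \<in> verts G \<and> (f u, f v) \<in> adj H ^^ n"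
proof (induction n arbitrary: v)
  case 0 then show ?case using assms by simp
next
  case (Suc n)
  then obtain w where w: "(u, w) \<in> adj G ^^ n" "(w, v) \<in> adj G" by auto
  have "(f w, f v) \<in> adj H"
    using w(2) graph_adj_verts[OF assms(1) w(2)] assms(2) by (auto simp: adj_def graph_iso_def)
  with w Suc.IH graph_adj_verts[OF assms(1) w(2)] show ?case by auto
qed

lemma graph_iso_gdist:
  assumes "lf_graph G" "lf_graph H" "graph_iso f G H" "u \<in> verts G" "v \<in> verts G"
  shows "gdist H (f u) (f v) = gdist G u v"
proof -
  let ?g = "inv_into (verts G) f"
  have b: "bij_betw f (verts G) (verts H)" using assms(3) by (simp add: graph_iso_def)
  have g: "?g (f u) = u" "?g (f v) = v" using b assms by (auto simp: bij_betw_def)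
  have "f u \<in> verts H" using b assms by (auto dest: bij_betwE)
  then have "(f u, f v) \<in> adj H ^^ n \<longleftrightarrow> (u, v) \<in> adj G ^^ n" for n
    using graph_iso_relpow[OF assms(1,3,4)] graph_iso_relpow[OF assms(2) graph_iso_inv[OF assms(3)]]
      g by metis
  then show ?thesis by (simp add: gdist_def)
qed

lemma gdist_relpow:
  assumes "lf_graph G" "u \<in> verts G" "v \<in> verts G"
  shows "(u, v) \<in> adj G ^^ gdist G u v"
proof -
  have "\<exists>n. (u, v) \<in> adj G ^^ n"
    using assms by (auto simp: lf_graph_def rtrancl_power)
  then show ?thesis unfolding gdist_def by (rule LeastI_ex)
qed

lemma gdist_le: "(u, v) \<in> adj G ^^ n \<Longrightarrow> gdist G u v \<le> n"
  unfolding gdist_def by (rule Least_le)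

lemma gdist_self [simp]: "gdist G x x = 0"
  using gdist_le[of x x 0 G] by simp

text \<open>Any isomorphism between balls of radius \<open>r\<close> is contracting on the balls of radius \<open>s \<le> r\<close>.\<close>

lemma ball_iso_contract:
  assumes G: "lf_graph G" and H: "lf_graph H" and xs: "set xs \<subseteq> verts G"
    and iso: "graph_iso f (induced_subgraph G (\<Union>x\<in>set xs. gball G x r)) (induced_subgraph H (\<Union>x\<in>set xs. gball H (f x) r))"
    and x: "x \<in> set xs" and v: "(x, v) \<in> adj G ^^ n" and n: "n \<le> r"
  shows "(f x, f v) \<in> adj H ^^ n \<and> v \<in> verts G"
  using v n
proof (induction n arbitrary: v)
  case 0 then show ?case using x xs by auto
next
  case (Suc n)
  then obtain w where w: "(x, w) \<in> adj G ^^ n" "(w, v) \<in> adj G" by auto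
  have vw: "v \<in> verts G" "w \<in> verts G" using graph_adj_verts[OF G w(2)] by auto
  have "gdist G x w \<le> n" "gdist G x v \<le> Suc n"
    using w(1) Suc.prems(1) gdist_le by blast+
  then have in_ball: "w \<in> (\<Union>x\<in>set xs. gball G x r)" "v \<in> (\<Union>x\<in>set xs. gball G x r)"
    using x vw Suc.prems(2) by (auto simp: gball_def intro!: bexI[of _ x])
  then have "emult (induced_subgraph H (\<Union>x\<in>set xs. gball H (f x) r)) (f w) (f v) = emult G w v"
    using iso vw unfolding graph_iso_def by (simp add: induced_subgraph_def)
  then have "(f w, f v) \<in> adj H"
    using w(2) by (auto simp: adj_def induced_subgraph_def split: if_splits)
  moreover have "(f x, f w) \<in> adj H ^^ n" using Suc.IH[OF w(1)] Suc.prems(2) by simp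
  ultimately show ?case using vw by auto
qed

lemma ball_iso_mono:
  assumes G: "lf_graph G" and H: "lf_graph H" and xs: "set xs \<subseteq> verts G" and ys: "set ys \<subseteq> verts H"
    and iso: "ball_iso r G xs H ys" and s: "s \<le> r"
  shows "ball_iso s G xs H ys"
proof -
  let ?B = "\<lambda>t. \<Union>x\<in>set xs. gball G x t" and ?C = "\<lambda>t. \<Union>y\<in>set ys. gball H y t"
  obtain f where f: "graph_iso f (induced_subgraph G (?B r)) (induced_subgraph H (?C r))" and fxs: "map f xs = ys"
    using iso by (auto simp: ball_iso_def rooted_iso_def)
  let ?g = "inv_into (?B r) f"
  have vB: "verts (induced_subgraph G (?B t)) = ?B t" and vC: "verts (induced_subgraph H (?C t)) = ?C t" for t
    by (auto simp: induced_subgraph_def gball_def)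
  have ysf: "set ys = f ` set xs" using fxs by auto
  have bij: "bij_betw f (?B r) (?C r)" using f unfolding graph_iso_def vB vC by simp
  have xB: "set xs \<subseteq> ?B t" for t using xs by (auto simp: gball_def)
  have gf: "?g (f v) = v" if "v \<in> ?B r" for v using bij that by (simp add: bij_betw_def)
  have fg: "f (?g v) = v" if "v \<in> ?C r" for v using bij that by (simp add: bij_betw_def f_inv_into_f)
  have gys: "map ?g ys = xs" using gf xB[of r] unfolding fxs[symmetric] map_map
    by (intro map_idI) (metis comp_apply subsetD)
  have xsg: "set xs = ?g ` set ys" using gys by (metis set_map)
  have g: "graph_iso ?g (induced_subgraph H (?C r)) (induced_subgraph G (?B r))"
    using graph_iso_inv[OF f] unfolding vB .
  have "(\<Union>x\<in>set xs. gball H (f x) r) = ?C r" unfolding ysf by simp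
  then have f': "graph_iso f (induced_subgraph G (?B r))
      (induced_subgraph H (\<Union>x\<in>set xs. gball H (f x) r))"
    using f by (simp only:)
  have "(\<Union>y\<in>set ys. gball G (?g y) r) = (\<Union>x\<in>?g ` set ys. gball G x r)" by simp
  then have "(\<Union>y\<in>set ys. gball G (?g y) r) = ?B r" by (simp only: xsg[symmetric])
  then have g': "graph_iso ?g (induced_subgraph H (?C r))
      (induced_subgraph G (\<Union>y\<in>set ys. gball G (?g y) r))"
    using g by (simp only:)
  have sub: "?B s \<subseteq> ?B r" "?C s \<subseteq> ?C r" using s by (auto simp: gball_def)
  have 1: "f v \<in> ?C s" if v: "v \<in> ?B s" for v
  proof -
    obtain x where x: "x \<in> set xs" "v \<in> verts G" "gdist G x v \<le> s" using v by (auto simp: gball_def)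
    have xv: "x \<in> verts G" using x(1) xs by blast
    have "(f x, f v) \<in> adj H ^^ gdist G x v"
      using ball_iso_contract[OF G H xs f' x(1) gdist_relpow[OF G xv x(2)]] x(3) s by simp
    then have "gdist H (f x) (f v) \<le> s" using gdist_le x(3) le_trans by blast
    moreover have "v \<in> ?B r" using v sub(1) by blast
    then have "f v \<in> ?C r" using bij by (meson bij_betwE)
    then have "f v \<in> verts H" by (auto simp: gball_def)
    moreover have "f x \<in> set ys" using x(1) ysf by blast
    ultimately show ?thesis unfolding gball_def by blast
  qed
  have 2: "?g v \<in> ?B s" if v: "v \<in> ?C s" for v
  proof -
    obtain y where y: "y \<in> set ys" "v \<in> verts H" "gdist H y v \<le> s" using v by (auto simp: gball_def)
    have yv: "y \<in> verts H" using y(1) ys by blast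
    have "(?g y, ?g v) \<in> adj G ^^ gdist H y v"
      using ball_iso_contract[OF H G ys g' y(1) gdist_relpow[OF H yv y(2)]] y(3) s by simp
    then have "gdist G (?g y) (?g v) \<le> s" using gdist_le y(3) le_trans by blast
    moreover have "v \<in> ?C r" using v sub(2) by blast
    then have "?g v \<in> ?B r" using bij by (metis bij_betw_def inv_into_into)
    then have "?g v \<in> verts G" by (auto simp: gball_def)
    moreover have "?g y \<in> set xs" using y(1) xsg by blast
    ultimately show ?thesis unfolding gball_def by blast
  qed
  have "f ` ?B s = ?C s"
  proof
    show "f ` ?B s \<subseteq> ?C s" using 1 by blast
    show "?C s \<subseteq> f ` ?B s"
    proof
      fix v assume v: "v \<in> ?C s"
      then have "f (?g v) = v" using fg sub(2) by blast
      then show "v \<in> f ` ?B s" using 2[OF v] by (rule image_eqI[OF sym])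
    qed
  qed
  then have "bij_betw f (?B s) (?C s)" using bij sub unfolding bij_betw_def by (meson inj_on_subset)
  moreover have "emult (induced_subgraph H (?C s)) (f u) (f v) = emult (induced_subgraph G (?B s)) u v"
    if "u \<in> ?B s" "v \<in> ?B s" for u v
  proof -
    have r: "u \<in> ?B r" "v \<in> ?B r" using that sub(1) by (blast dest: subsetD)+
    have C: "f u \<in> ?C s" "f v \<in> ?C s" using 1[OF that(1)] 1[OF that(2)] by -
    then have Cr: "f u \<in> ?C r" "f v \<in> ?C r" using sub(2) by (blast dest: subsetD)+
    have "\<forall>u\<in>?B r. \<forall>v\<in>?B r.
        emult (induced_subgraph H (?C r)) (f u) (f v) = emult (induced_subgraph G (?B r)) u v"
      using f unfolding graph_iso_def vB by (rule conjunct2)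
    then have "emult (induced_subgraph H (?C r)) (f u) (f v) = emult (induced_subgraph G (?B r)) u v"
      using r by (simp only: Ball_def)
    then show ?thesis using that r C Cr
      by (simp only: induced_subgraph_def multigraph.simps if_True simp_thms)
  qed
  ultimately have "graph_iso f (induced_subgraph G (?B s)) (induced_subgraph H (?C s))"
    unfolding graph_iso_def vB vC by simp
  then show ?thesis using fxs by (auto simp: ball_iso_def rooted_iso_def)
qed

lemma ball_iso_refl: "ball_iso r G xs G xs"
  by (simp add: ball_iso_def rooted_iso_refl)

lemma ball_iso_sym:
  "set xs \<subseteq> verts G \<Longrightarrow> ball_iso r G xs H ys \<Longrightarrow> ball_iso r H ys G xs"
  unfolding ball_iso_def by (rule rooted_iso_sym) (auto simp: induced_subgraph_def gball_def)

lemma ball_iso_trans: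
  "ball_iso r G xs H ys \<Longrightarrow> ball_iso r H ys K zs \<Longrightarrow> ball_iso r G xs K zs"
  unfolding ball_iso_def by (rule rooted_iso_trans)

lemma rooted_iso_ball_iso:
  assumes G: "lf_graph G" and H: "lf_graph H" and xs: "set xs \<subseteq> verts G"
    and iso: "rooted_iso G xs H ys"
  shows "ball_iso r G xs H ys"
proof -
  obtain f where f: "graph_iso f G H" and fxs: "map f xs = ys"
    using iso by (auto simp: rooted_iso_def)
  let ?B = "\<Union>x\<in>set xs. gball G x r" and ?C = "\<Union>y\<in>set ys. gball H y r"
  have vB: "verts (induced_subgraph G ?B) = ?B" and vC: "verts (induced_subgraph H ?C) = ?C"
    by (auto simp: induced_subgraph_def gball_def)
  have bij: "bij_betw f (verts G) (verts H)" using f by (simp add: graph_iso_def)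
  have ysf: "set ys = f ` set xs" using fxs by auto
  have img: "f ` gball G x r = gball H (f x) r" if "x \<in> set xs" for x
  proof -
    have "gdist H (f x) (f v) = gdist G x v" if "v \<in> verts G" for v
      using graph_iso_gdist[OF G H f _ that] \<open>x \<in> set xs\<close> xs by auto
    moreover have "verts H = f ` verts G" using bij by (simp add: bij_betw_def)
    ultimately show ?thesis by (auto simp: gball_def)
  qed
  have sub: "?B \<subseteq> verts G" by (auto simp: gball_def)
  have fB: "f ` ?B = ?C" unfolding ysf image_UN using img by simp
  have "bij_betw f ?B ?C"
    unfolding bij_betw_def using fB bij sub by (meson bij_betw_def inj_on_subset)
  moreover have "emult (induced_subgraph H ?C) (f u) (f v) = emult (induced_subgraph G ?B) u v"
    if "u \<in> ?B" "v \<in> ?B" for u v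
  proof -
    have "f u \<in> ?C" "f v \<in> ?C" using that fB by blast+
    moreover have "emult H (f u) (f v) = emult G u v"
      using f that sub unfolding graph_iso_def by blast
    ultimately show ?thesis using that unfolding induced_subgraph_def by simp
  qed
  ultimately have "graph_iso f (induced_subgraph G ?B) (induced_subgraph H ?C)"
    unfolding graph_iso_def vB vC by simp
  then show ?thesis using fxs by (auto simp: ball_iso_def rooted_iso_def)
qed


text \<open>The spaces of isomorphism classes of graphs with one root and with two ordered roots.\<close>

quotient_type rooted_graph = "multigraph \<times> nat" / partial:
  "\<lambda>(G, x) (H, y). lf_graph G \<and> x \<in> verts G \<and> lf_graph H \<and> y \<in> verts H \<and> rooted_iso G [x] H [y]"
proof (rule part_equivpI)
  let ?P = "\<lparr>verts = {0}, emult = (\<lambda>_ _. 0)\<rparr>"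
  have "lf_graph ?P" by (auto simp: lf_graph_def adj_def)
  then show "\<exists>p. (\<lambda>(G, x) (H, y). lf_graph G \<and> x \<in> verts G \<and> lf_graph H \<and> y \<in> verts H \<and>
      rooted_iso G [x] H [y]) p p"
    by (intro exI[of _ "(?P, 0)"]) (simp add: rooted_iso_refl)
qed (auto intro!: sympI transpI intro: rooted_iso_sym rooted_iso_trans)

quotient_type birooted_graph = "multigraph \<times> nat \<times> nat" / partial:
  "\<lambda>(G, x, x') (H, y, y'). lf_graph G \<and> x \<in> verts G \<and> x' \<in> verts G \<and>
     lf_graph H \<and> y \<in> verts H \<and> y' \<in> verts H \<and> rooted_iso G [x, x'] H [y, y']"
proof (rule part_equivpI)
  let ?P = "\<lparr>verts = {0}, emult = (\<lambda>_ _. 0)\<rparr>"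
  have "lf_graph ?P" by (auto simp: lf_graph_def adj_def)
  then show "\<exists>p. (\<lambda>(G, x, x') (H, y, y'). lf_graph G \<and> x \<in> verts G \<and> x' \<in> verts G \<and>
     lf_graph H \<and> y \<in> verts H \<and> y' \<in> verts H \<and> rooted_iso G [x, x'] H [y, y']) p p"
    by (intro exI[of _ "(?P, 0, 0)"]) (simp add: rooted_iso_refl)
qed (auto intro!: sympI transpI intro: rooted_iso_sym rooted_iso_trans)

lemma ball_iso_cong:
  assumes "lf_graph G" "lf_graph G'" "lf_graph H" "lf_graph H'"
    and "set xs \<subseteq> verts G" "set xs' \<subseteq> verts G'" "set ys \<subseteq> verts H" "set ys' \<subseteq> verts H'"
    and "rooted_iso G xs G' xs'" "rooted_iso H ys H' ys'"
  shows "ball_iso r G xs H ys \<longleftrightarrow> ball_iso r G' xs' H' ys'"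
  using assms by (meson rooted_iso_ball_iso ball_iso_sym ball_iso_trans)

lift_definition same_ball :: "nat \<Rightarrow> rooted_graph \<Rightarrow> rooted_graph \<Rightarrow> bool" is
  "\<lambda>r (G, x) (H, y). ball_iso r G [x] H [y]"
  by (clarsimp, rule ball_iso_cong) auto

lift_definition same_ball2 :: "nat \<Rightarrow> birooted_graph \<Rightarrow> birooted_graph \<Rightarrow> bool" is
  "\<lambda>r (G, x, x') (H, y, y'). ball_iso r G [x, x'] H [y, y']"
  by (clarsimp, rule ball_iso_cong) auto

lemma same_ball_refl: "same_ball r g g"
  by transfer (auto intro: ball_iso_refl)

lemma same_ball_trans: "same_ball r g h \<Longrightarrow> same_ball r h k \<Longrightarrow> same_ball r g k"
  by transfer (auto intro: ball_iso_trans)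

lemma same_ball_mono: "same_ball r g h \<Longrightarrow> s \<le> r \<Longrightarrow> same_ball s g h"
  by transfer (auto intro: ball_iso_mono)

lemma same_ball2_mono: "same_ball2 r g h \<Longrightarrow> s \<le> r \<Longrightarrow> same_ball2 s g h"
  by transfer (auto intro: ball_iso_mono)

instantiation rooted_graph :: topological_space
begin

definition open_rooted_graph :: "rooted_graph set \<Rightarrow> bool" where
  "open_rooted_graph U \<longleftrightarrow> (\<forall>g\<in>U. \<exists>r. \<forall>h. same_ball r g h \<longrightarrow> h \<in> U)"

instance
proof
  fix S T :: "rooted_graph set" assume ST: "open S" "open T"
  show "open (S \<inter> T)" unfolding open_rooted_graph_def
  proof
    fix g assume "g \<in> S \<inter> T"
    then obtain r s where "\<forall>h. same_ball r g h \<longrightarrow> h \<in> S" "\<forall>h. same_ball s g h \<longrightarrow> h \<in> T"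
      using ST unfolding open_rooted_graph_def by blast
    then show "\<exists>r. \<forall>h. same_ball r g h \<longrightarrow> h \<in> S \<inter> T"
      by (intro exI[of _ "max r s"]) (auto dest: same_ball_mono[where s = r] same_ball_mono[where s = s])
  qed
next
  fix K :: "rooted_graph set set" assume K: "\<forall>S\<in>K. open S"
  show "open (\<Union>K)" unfolding open_rooted_graph_def
  proof
    fix g assume "g \<in> \<Union>K"
    then obtain S where S: "S \<in> K" "g \<in> S" by blast
    then obtain r where "\<forall>h. same_ball r g h \<longrightarrow> h \<in> S"
      using K unfolding open_rooted_graph_def by blast
    with S(1) show "\<exists>r. \<forall>h. same_ball r g h \<longrightarrow> h \<in> \<Union>K" by blast
  qed
qed (simp add: open_rooted_graph_def)

end

instantiation birooted_graph :: topological_space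
begin

definition open_birooted_graph :: "birooted_graph set \<Rightarrow> bool" where
  "open_birooted_graph U \<longleftrightarrow> (\<forall>g\<in>U. \<exists>r. \<forall>h. same_ball2 r g h \<longrightarrow> h \<in> U)"

instance
proof
  fix S T :: "birooted_graph set" assume ST: "open S" "open T"
  show "open (S \<inter> T)" unfolding open_birooted_graph_def
  proof
    fix g assume "g \<in> S \<inter> T"
    then obtain r s where "\<forall>h. same_ball2 r g h \<longrightarrow> h \<in> S" "\<forall>h. same_ball2 s g h \<longrightarrow> h \<in> T"
      using ST unfolding open_birooted_graph_def by blast
    then show "\<exists>r. \<forall>h. same_ball2 r g h \<longrightarrow> h \<in> S \<inter> T"
      by (intro exI[of _ "max r s"]) (auto dest: same_ball2_mono[where s = r] same_ball2_mono[where s = s])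
  qed
next
  fix K :: "birooted_graph set set" assume K: "\<forall>S\<in>K. open S"
  show "open (\<Union>K)" unfolding open_birooted_graph_def
  proof
    fix g assume "g \<in> \<Union>K"
    then obtain S where S: "S \<in> K" "g \<in> S" by blast
    then obtain r where "\<forall>h. same_ball2 r g h \<longrightarrow> h \<in> S"
      using K unfolding open_birooted_graph_def by blast
    with S(1) show "\<exists>r. \<forall>h. same_ball2 r g h \<longrightarrow> h \<in> \<Union>K" by blast
  qed
qed (simp add: open_birooted_graph_def)

end

lemma tendsto_rooted_graph_iff:
  fixes g :: "nat \<Rightarrow> rooted_graph"
  shows "g \<longlonglongrightarrow> l \<longleftrightarrow> (\<forall>r. \<forall>\<^sub>F n in sequentially. same_ball r l (g n))"
proof
  assume g: "g \<longlonglongrightarrow> l"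
  show "\<forall>r. \<forall>\<^sub>F n in sequentially. same_ball r l (g n)"
  proof
    fix r
    have "open {h. same_ball r l h}"
      unfolding open_rooted_graph_def using same_ball_trans by blast
    then have "\<forall>\<^sub>F n in sequentially. g n \<in> {h. same_ball r l h}"
      using topological_tendstoD[OF g] same_ball_refl by blast
    then show "\<forall>\<^sub>F n in sequentially. same_ball r l (g n)" by simp
  qed
next
  assume r: "\<forall>r. \<forall>\<^sub>F n in sequentially. same_ball r l (g n)"
  show "g \<longlonglongrightarrow> l"
  proof (rule topological_tendstoI)
    fix U :: "rooted_graph set" assume "open U" "l \<in> U"
    then obtain s where "\<forall>h. same_ball s l h \<longrightarrow> h \<in> U"
      unfolding open_rooted_graph_def by blast
    with r show "\<forall>\<^sub>F n in sequentially. g n \<in> U"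
      by (metis (mono_tags, lifting) eventually_mono)
  qed
qed


lemma graph_iso_deg:
  assumes "lf_graph G" "lf_graph H" "graph_iso f G H" "v \<in> verts G"
  shows "deg H (f v) = deg G v"
proof -
  have b: "bij_betw f (verts G) (verts H)"
    and m: "\<And>u v. u \<in> verts G \<Longrightarrow> v \<in> verts G \<Longrightarrow> emult H (f u) (f v) = emult G u v"
    using assms by (auto simp: graph_iso_def)
  have G: "w \<in> verts G" if "emult G u w > 0" for u w
    using assms(1) that by (auto simp: lf_graph_def adj_def)
  have H: "w \<in> verts H" if "emult H u w > 0" for u w
    using assms(2) that by (auto simp: lf_graph_def adj_def)
  have "f ` {w. emult G v w > 0} = {w. emult H (f v) w > 0}"
  proof (intro equalityI subsetI)
    fix w assume w: "w \<in> {w. emult H (f v) w > 0}"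
    then have "w \<in> f ` verts G" using H b by (simp add: bij_betw_def)
    then obtain u where "u \<in> verts G" "w = f u" by blast
    then show "w \<in> f ` {w. emult G v w > 0}" using w m[OF assms(4)] by auto
  qed (use G m[OF assms(4)] in auto)
  moreover have "inj_on f {w. emult G v w > 0}"
    using b G by (auto simp: bij_betw_def intro: inj_on_subset)
  ultimately have "bij_betw f {w. emult G v w > 0} {w. emult H (f v) w > 0}"
    by (simp add: bij_betw_def)
  then show ?thesis
    unfolding deg_def by (rule sum.reindex_bij_betw[symmetric, THEN trans])
      (auto intro!: sum.cong simp: m[OF assms(4)] G)
qed

lemma graph_iso_gsphere:
  assumes "lf_graph G" "lf_graph H" "graph_iso f G H" "x \<in> verts G"
  shows "bij_betw f (gsphere G x r) (gsphere H (f x) r)" "bij_betw f (gball G x r) (gball H (f x) r)"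
proof -
  have b: "bij_betw f (verts G) (verts H)" using assms by (auto simp: graph_iso_def)
  then have v: "verts H = f ` verts G" by (simp add: bij_betw_def)
  have *: "gsphere H (f x) r = f ` gsphere G x r" "gball H (f x) r = f ` gball G x r"
    using graph_iso_gdist[OF assms] v by (auto simp: gsphere_def gball_def)
  show "bij_betw f (gsphere G x r) (gsphere H (f x) r)" "bij_betw f (gball G x r) (gball H (f x) r)"
    unfolding * using b by (auto simp: bij_betw_def gsphere_def gball_def intro: inj_on_subset)
qed

lift_definition root_deg :: "rooted_graph \<Rightarrow> nat" is "\<lambda>(G, x). deg G x"
  by (auto simp: rooted_iso_def graph_iso_deg)

lift_definition sphere_size :: "nat \<Rightarrow> rooted_graph \<Rightarrow> nat" is "\<lambda>r (G, x). card (gsphere G x r)"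
  by (auto simp: rooted_iso_def intro!: bij_betw_same_card[OF graph_iso_gsphere(1)])

lift_definition ball_size :: "nat \<Rightarrow> rooted_graph \<Rightarrow> nat" is "\<lambda>r (G, x). card (gball G x r)"
  by (auto simp: rooted_iso_def intro!: bij_betw_same_card[OF graph_iso_gsphere(2)])


definition birooted_class :: "multigraph \<Rightarrow> nat \<Rightarrow> nat \<Rightarrow> birooted_graph" where
  "birooted_class G x y = abs_birooted_graph (G, x, y)"

lemma birooted_class_cong:
  assumes "lf_graph G" "lf_graph H" "graph_iso f G H" "x \<in> verts G" "y \<in> verts G"
  shows "birooted_class H (f x) (f y) = birooted_class G x y"
proof -
  have "f x \<in> verts H" "f y \<in> verts H" using assms by (auto simp: graph_iso_def dest: bij_betwE)
  moreover have "rooted_iso G [x, y] H [f x, f y]" using assms by (auto simp: rooted_iso_def)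
  ultimately show ?thesis unfolding birooted_class_def
    using assms by (intro Quotient3_rel_abs[OF Quotient3_birooted_graph, symmetric]) simp
qed

text \<open>\<open>mass_out F\<close> and \<open>mass_in F\<close> send the class of \<open>(X, x)\<close> to the sums over \<open>y\<close> of \<open>F(X, x, y)\<close> and
  of \<open>F(X, y, x)\<close>, valued in \<open>[0, \<infinity>]\<close>.\<close>

lift_definition mass_out :: "(birooted_graph \<Rightarrow> real) \<Rightarrow> rooted_graph \<Rightarrow> ennreal" is
  "\<lambda>F (G, x). \<Sum>\<^sub>\<infinity>y\<in>verts G. ennreal (F (birooted_class G x y))"
proof (clarsimp simp: rooted_iso_def)
  fix F :: "birooted_graph \<Rightarrow> real" and G H f x
  assume *: "lf_graph G" "lf_graph H" "graph_iso f G H" "x \<in> verts G"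
  have "bij_betw f (verts G) (verts H)" using * by (simp add: graph_iso_def)
  from infsum_reindex_bij_betw[OF this, symmetric]
  show "(\<Sum>\<^sub>\<infinity>y\<in>verts G. ennreal (F (birooted_class G x y))) =
        (\<Sum>\<^sub>\<infinity>y\<in>verts H. ennreal (F (birooted_class H (f x) y)))"
    by (rule trans[rotated, OF sym]) (auto intro!: infsum_cong simp: birooted_class_cong[OF *])
qed

lift_definition mass_in :: "(birooted_graph \<Rightarrow> real) \<Rightarrow> rooted_graph \<Rightarrow> ennreal" is
  "\<lambda>F (G, x). \<Sum>\<^sub>\<infinity>y\<in>verts G. ennreal (F (birooted_class G y x))"
proof (clarsimp simp: rooted_iso_def)
  fix F :: "birooted_graph \<Rightarrow> real" and G H f x
  assume *: "lf_graph G" "lf_graph H" "graph_iso f G H" "x \<in> verts G"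
  have "bij_betw f (verts G) (verts H)" using * by (simp add: graph_iso_def)
  from infsum_reindex_bij_betw[OF this, symmetric]
  show "(\<Sum>\<^sub>\<infinity>y\<in>verts G. ennreal (F (birooted_class G y x))) =
        (\<Sum>\<^sub>\<infinity>y\<in>verts H. ennreal (F (birooted_class H y (f x))))"
    by (rule trans[rotated, OF sym]) (auto intro!: infsum_cong simp: birooted_class_cong[OF *(1-3) _ *(4)])
qed

definition random_rooted_graph :: "'w measure \<Rightarrow> ('w \<Rightarrow> rooted_graph) \<Rightarrow> bool" where
  "random_rooted_graph M X \<longleftrightarrow> prob_space M \<and> X \<in> borel_measurable M"

definition unimodular :: "'w measure \<Rightarrow> ('w \<Rightarrow> rooted_graph) \<Rightarrow> bool" where
  "unimodular M X \<longleftrightarrow>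
     (\<forall>F \<in> borel_measurable borel. (\<forall>g. 0 \<le> F g) \<longrightarrow>
        (\<integral>\<^sup>+ \<omega>. mass_out F (X \<omega>) \<partial>M) = (\<integral>\<^sup>+ \<omega>. mass_in F (X \<omega>) \<partial>M))"

text \<open>The logarithm is nonnegative because \<open>ball_size r g \<ge> 1\<close>, so its expectation exists in
  \<open>[0, \<infinity>]\<close>.  The term at \<open>r = 0\<close>, where \<open>inverse 0 = \<infinity>\<close>, does not affect the lower limit.\<close>

definition volume_growth :: "'w measure \<Rightarrow> ('w \<Rightarrow> rooted_graph) \<Rightarrow> ennreal" where
  "volume_growth M X =
     liminf (\<lambda>r. inverse (of_nat r) * (\<integral>\<^sup>+ \<omega>. ennreal (ln (real (ball_size r (X \<omega>)))) \<partial>M))"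

end

theory Submission
  imports Defs
begin

text \<open>
  Each vertex of \<open>S\<^bsub>r+1\<^esub>(x)\<close> has a neighbour in \<open>S\<^sub>r(x)\<close>, so \<open>|S\<^bsub>r+1\<^esub>(x)|\<close> is at most the sum
  of the degrees over \<open>S\<^sub>r(x)\<close>.  By unimodularity the expectation of this sum is that of
  \<open>deg(x) |S\<^sub>r(x)|\<close>, which the hypothesis bounds by \<open>C\<close> times that of \<open>|S\<^sub>r(x)|\<close>.  Hence the expected
  size of the spheres, and so that of the balls, grows at most exponentially, and concavity of the
  logarithm gives the claim.
\<close>

section \<open>Distance, spheres and balls in a locally finite graph\<close>

lemma adj_relpow_commute:
  assumes "lf_graph G"
  shows "(u, v) \<in> adj G ^^ n \<Longrightarrow> (v, u) \<in> adj G ^^ n"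
proof (induction n arbitrary: v)
  case (Suc n)
  then obtain w where w: "(u, w) \<in> adj G ^^ n" "(w, v) \<in> adj G" by auto
  then have "(v, w) \<in> adj G" using assms by (simp add: adj_def lf_graph_def)
  then show ?case using Suc.IH[OF w(1)] by (rule relpow_Suc_I2)
qed simp

lemma gdist_commute:
  assumes "lf_graph G"
  shows "gdist G u v = gdist G v u"
proof -
  have "(u, v) \<in> adj G ^^ n \<longleftrightarrow> (v, u) \<in> adj G ^^ n" for n
    using adj_relpow_commute[OF assms] by blast
  then show ?thesis by (simp add: gdist_def)
qed

lemma gdist_eq_0_iff:
  assumes "lf_graph G" "u \<in> verts G" "v \<in> verts G"
  shows "gdist G u v = 0 \<longleftrightarrow> u = v"
  using gdist_relpow[OF assms] by auto

lemma gsphere_0: "lf_graph G \<Longrightarrow> x \<in> verts G \<Longrightarrow> gsphere G x 0 = {x}"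
  by (auto simp: gsphere_def gdist_eq_0_iff)

text \<open>The neighbour is the penultimate vertex \<open>w\<close> of a path of length
  \<open>Suc r\<close> from \<open>x\<close> to \<open>v\<close>. It is at distance at most
  \<open>r\<close>, and not less, since otherwise \<open>v\<close> would be closer to
  \<open>x\<close> than \<open>Suc r\<close>.\<close>

lemma gsphere_Suc_subset:
  assumes "lf_graph G" "x \<in> verts G"
  shows "gsphere G x (Suc r) \<subseteq> (\<Union>y\<in>gsphere G x r. {w. emult G y w > 0})"
proof
  fix v assume v: "v \<in> gsphere G x (Suc r)"
  then have "(x, v) \<in> adj G ^^ Suc r"
    using gdist_relpow[OF assms, of v] by (simp add: gsphere_def)
  then obtain w where w: "(x, w) \<in> adj G ^^ r" "(w, v) \<in> adj G" by auto
  have wv: "w \<in> verts G" using graph_adj_verts[OF assms(1) w(2)] by simp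
  have "(x, v) \<in> adj G ^^ Suc (gdist G x w)"
    using gdist_relpow[OF assms wv] w(2) by auto
  then have "Suc r \<le> Suc (gdist G x w)"
    using v gdist_le by (fastforce simp: gsphere_def)
  with gdist_le[OF w(1)] wv have "w \<in> gsphere G x r" by (simp add: gsphere_def)
  with w(2) show "v \<in> (\<Union>y\<in>gsphere G x r. {w. emult G y w > 0})" by (auto simp: adj_def)
qed

lemma finite_gsphere:
  assumes "lf_graph G" "x \<in> verts G"
  shows "finite (gsphere G x r)"
proof (induction r)
  case 0 then show ?case using assms by (simp add: gsphere_0)
next
  case (Suc r)
  have "finite {w. emult G y w > 0}" if "y \<in> gsphere G x r" for y
    using that assms by (auto simp: gsphere_def lf_graph_def)
  with Suc have "finite (\<Union>y\<in>gsphere G x r. {w. emult G y w > 0})" by blast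
  then show ?case by (rule finite_subset[OF gsphere_Suc_subset[OF assms]])
qed

lemma gball_0: "gball G x 0 = gsphere G x 0"
  by (auto simp: gball_def gsphere_def)

lemma gball_Suc: "gball G x (Suc r) = gball G x r \<union> gsphere G x (Suc r)"
  by (auto simp: gball_def gsphere_def)

lemma finite_gball:
  assumes "lf_graph G" "x \<in> verts G"
  shows "finite (gball G x r)"
  by (induction r) (simp_all add: gball_0 gball_Suc finite_gsphere[OF assms])

lemma card_gball_Suc:
  assumes "lf_graph G" "x \<in> verts G"
  shows "card (gball G x (Suc r)) = card (gball G x r) + card (gsphere G x (Suc r))"
  unfolding gball_Suc
  by (rule card_Un_disjoint[OF finite_gball[OF assms] finite_gsphere[OF assms]])
    (auto simp: gball_def gsphere_def)

lemma card_neighbours_le_deg: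
  "card {w. emult G v w > 0} \<le> deg G v"
proof -
  have "(\<Sum>w | emult G v w > 0. 1) \<le> (\<Sum>w | emult G v w > 0. emult G v w)"
    by (intro sum_mono) auto
  then show ?thesis by (simp add: deg_def)
qed

lemma card_gsphere_Suc_le:
  assumes "lf_graph G" "x \<in> verts G"
  shows "card (gsphere G x (Suc r)) \<le> (\<Sum>y\<in>gsphere G x r. deg G y)"
proof -
  have "finite {w. emult G y w > 0}" if "y \<in> gsphere G x r" for y
    using that assms by (auto simp: gsphere_def lf_graph_def)
  then have "card (gsphere G x (Suc r)) \<le> card (\<Union>y\<in>gsphere G x r. {w. emult G y w > 0})"
    by (intro card_mono gsphere_Suc_subset assms finite_UN_I finite_gsphere) auto
  also have "\<dots> \<le> (\<Sum>y\<in>gsphere G x r. card {w. emult G y w > 0})"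
    by (intro card_UN_le finite_gsphere assms)
  also have "\<dots> \<le> (\<Sum>y\<in>gsphere G x r. deg G y)"
    by (intro sum_mono card_neighbours_le_deg)
  finally show ?thesis .
qed

section \<open>Sizes, distances and degrees determined by a ball\<close>

lemma sphere_size_0: "sphere_size 0 g = 1"
  by transfer (auto simp: gsphere_0)

lemma ball_size_0: "ball_size 0 g = 1"
  by transfer (auto simp: gsphere_0 gball_0)

lemma ball_size_Suc: "ball_size (Suc r) g = ball_size r g + sphere_size (Suc r) g"
  by transfer (auto simp: card_gball_Suc)

lemma ball_size_pos: "ball_size r g > 0"
  by (induction r) (auto simp: ball_size_0 ball_size_Suc)

lemma ball_iso_card_gball:
  assumes "ball_iso r G [x] H [y]"
  shows "card (gball G x r) = card (gball H y r)"
proof -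
  have "verts (induced_subgraph K (gball K z r)) = gball K z r" for K z
    by (auto simp: induced_subgraph_def gball_def)
  then show ?thesis
    using assms by (auto simp: ball_iso_def rooted_iso_def graph_iso_def intro: bij_betw_same_card)
qed

lemma same_ball_ball_size: "same_ball r g h \<Longrightarrow> ball_size r g = ball_size r h"
  by transfer (auto intro: ball_iso_card_gball)

text \<open>A shortest path from \<open>x\<close> to \<open>x'\<close> has length at most
  \<open>r\<close>, so it stays inside the ball around \<open>x\<close> and the isomorphism carries
  it to a path in \<open>H\<close>.\<close>

lemma ball_iso_gdist_le:
  assumes G: "lf_graph G" and H: "lf_graph H" and x: "x \<in> verts G" "x' \<in> verts G"
    and iso: "ball_iso r G [x, x'] H [y, y']" and r: "gdist G x x' \<le> r"
  shows "gdist H y y' \<le> gdist G x x'"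
proof -
  obtain f where f: "graph_iso f (induced_subgraph G (\<Union>x\<in>set [x, x']. gball G x r))
      (induced_subgraph H (\<Union>x\<in>set [x, x']. gball H (f x) r))" and y: "f x = y" "f x' = y'"
    using iso by (auto simp: ball_iso_def rooted_iso_def)
  have "(f x, f x') \<in> adj H ^^ gdist G x x'"
    using ball_iso_contract[OF G H _ f _ gdist_relpow[OF G x] r] x by simp
  then show ?thesis unfolding y by (rule gdist_le)
qed

text \<open>If one of the distances equals \<open>s\<close>, it is at most \<open>r\<close>, so the
  other is no larger. Then that one is also at most \<open>r\<close>, and the reverse inequality
  becomes available.\<close>

lemma ball_iso_gdist_eq_iff:
  assumes "lf_graph G" "lf_graph H" "x \<in> verts G" "x' \<in> verts G" "y \<in> verts H" "y' \<in> verts H"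
    and iso: "ball_iso r G [x, x'] H [y, y']" and s: "s \<le> r"
  shows "gdist G x x' = s \<longleftrightarrow> gdist H y y' = s"
proof -
  have iso': "ball_iso r H [y, y'] G [x, x']" by (rule ball_iso_sym[OF _ iso]) (use assms in auto)
  show ?thesis
    using ball_iso_gdist_le[OF assms(1-4) iso] ball_iso_gdist_le[OF assms(2,1,5,6) iso'] s
    by linarith
qed

lemma deg_eq_sum:
  assumes "finite B" "{w. emult G v w > 0} \<subseteq> B"
  shows "deg G v = (\<Sum>w\<in>B. emult G v w)"
  unfolding deg_def using assms by (intro sum.mono_neutral_left) auto

lemma neighbours_subset_gball:
  assumes "lf_graph G" "r \<ge> 1"
  shows "{w. emult G v w > 0} \<subseteq> gball G v r"
proof
  fix w assume "w \<in> {w. emult G v w > 0}"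
  then have w: "(v, w) \<in> adj G" by (simp add: adj_def)
  then have "gdist G v w \<le> 1" by (intro gdist_le) simp
  with graph_adj_verts[OF assms(1) w] assms(2) show "w \<in> gball G v r" by (simp add: gball_def)
qed

text \<open>Radius 1 around \<open>x'\<close> already contains all its neighbours. Both degrees are
  therefore sums of multiplicities over the unions of balls, which the isomorphism matches term by
  term.\<close>

lemma ball_iso_deg:
  assumes G: "lf_graph G" and H: "lf_graph H" and "x \<in> verts G" "x' \<in> verts G" "y \<in> verts H" "y' \<in> verts H"
    and iso: "ball_iso r G [x, x'] H [y, y']" and r: "r \<ge> 1"
  shows "deg G x' = deg H y'"
proof -
  let ?B = "gball G x r \<union> gball G x' r" and ?C = "gball H y r \<union> gball H y' r"
  obtain f where f: "graph_iso f (induced_subgraph G ?B) (induced_subgraph H ?C)" and y: "f x' = y'"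
    using iso by (auto simp: ball_iso_def rooted_iso_def)
  have "verts (induced_subgraph G ?B) = ?B" "verts (induced_subgraph H ?C) = ?C"
    by (auto simp: induced_subgraph_def gball_def)
  with f have bij: "bij_betw f ?B ?C"
    and m: "\<And>u v. u \<in> ?B \<Longrightarrow> v \<in> ?B \<Longrightarrow>
      emult (induced_subgraph H ?C) (f u) (f v) = emult (induced_subgraph G ?B) u v"
    by (auto simp: graph_iso_def)
  have x': "x' \<in> ?B" using assms by (simp add: gball_def)
  have "emult H (f x') (f w) = emult G x' w" if w: "w \<in> ?B" for w
    using m[OF x' w] bij_betwE[OF bij] x' w by (simp add: induced_subgraph_def)
  then have "(\<Sum>w\<in>?B. emult G x' w) = (\<Sum>w\<in>?B. emult H y' (f w))"
    using y by (intro sum.cong) auto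
  also have "\<dots> = (\<Sum>w\<in>?C. emult H y' w)" by (rule sum.reindex_bij_betw[OF bij])
  finally have sums: "(\<Sum>w\<in>?B. emult G x' w) = (\<Sum>w\<in>?C. emult H y' w)" .
  have "deg G x' = (\<Sum>w\<in>?B. emult G x' w)"
    using assms neighbours_subset_gball[OF G r] by (intro deg_eq_sum) (auto intro: finite_gball)
  moreover have "deg H y' = (\<Sum>w\<in>?C. emult H y' w)"
    using assms neighbours_subset_gball[OF H r] by (intro deg_eq_sum) (auto intro: finite_gball)
  ultimately show ?thesis using sums by simp
qed

section \<open>The transported mass and measurability\<close>

text \<open>The function to which unimodularity is applied: the first root sends to each vertex of
  its sphere of radius \<open>r\<close> the degree of that vertex.\<close>

lift_definition sphere_deg :: "nat \<Rightarrow> birooted_graph \<Rightarrow> real" is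
  "\<lambda>r (G, x, y). if gdist G x y = r then real (deg G y) else 0"
  by (auto simp: rooted_iso_def graph_iso_deg graph_iso_gdist)

lemma sphere_deg_nonneg: "sphere_deg r g \<ge> 0"
  by transfer auto

lemma sphere_deg_birooted_class:
  assumes "lf_graph G" "x \<in> verts G" "y \<in> verts G"
  shows "sphere_deg r (birooted_class G x y) = (if gdist G x y = r then real (deg G y) else 0)"
  unfolding birooted_class_def by (subst sphere_deg.abs_eq) (auto simp: assms rooted_iso_refl)

text \<open>The radius must be at least \<open>r\<close> to detect the distance and at least 1 to
  see the degree; \<open>Suc r\<close> achieves both, even for \<open>r = 0\<close>.\<close>

lemma same_ball2_sphere_deg: "same_ball2 (Suc r) g h \<Longrightarrow> sphere_deg r h = sphere_deg r g"
proof (transfer, clarsimp, goal_cases)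
  case (1 r G x x' H y y')
  then show ?case
    using ball_iso_gdist_eq_iff[of G H x x' y y' "Suc r" r] ball_iso_deg[of G H x x' y y' "Suc r"]
    by simp
qed

text \<open>The function is locally constant, so the preimage of any set whatsoever is open. The
  same argument serves for \<open>ball_size\<close>.\<close>

lemma borel_measurable_sphere_deg: "sphere_deg r \<in> borel_measurable borel"
proof (rule borel_measurableI)
  fix S :: "real set"
  have "open (sphere_deg r -` S)"
    unfolding open_birooted_graph_def using same_ball2_sphere_deg by (metis vimage_eq)
  then show "sphere_deg r -` S \<inter> space borel \<in> sets borel" by simp
qed

lemma measurable_ball_size: "ball_size r \<in> borel \<rightarrow>\<^sub>M count_space UNIV"
proof (rule measurableI)
  fix A :: "nat set"
  have "open (ball_size r -` A)"
    unfolding open_rooted_graph_def using same_ball_ball_size by (metis vimage_eq)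
  then show "ball_size r -` A \<inter> space borel \<in> sets borel" by simp
qed simp

section \<open>Mass sums and the use of unimodularity\<close>

text \<open>Only finitely many terms survive, by local finiteness. The summand \<open>h\<close> is
  left general so that both outgoing and incoming mass are covered.\<close>

lemma infsum_gsphere:
  fixes f :: "nat \<Rightarrow> ennreal"
  assumes "lf_graph G" "x \<in> verts G" "\<And>y. y \<in> verts G \<Longrightarrow> h y = (if gdist G x y = r then f y else 0)"
  shows "(\<Sum>\<^sub>\<infinity>y\<in>verts G. h y) = (\<Sum>y\<in>gsphere G x r. f y)"
proof -
  have "(\<Sum>\<^sub>\<infinity>y\<in>verts G. h y) = (\<Sum>\<^sub>\<infinity>y\<in>gsphere G x r. f y)"
    by (rule infsum_cong_neutral) (auto simp: gsphere_def assms(3))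
  then show ?thesis using finite_gsphere[OF assms(1,2)] by simp
qed

lemma rooted_graph_cases:
  obtains G x where "g = abs_rooted_graph (G, x)" "lf_graph G" "x \<in> verts G"
  by (induction g rule: rooted_graph.abs_induct) auto

lemma sphere_size_Suc_le_mass_out: "of_nat (sphere_size (Suc r) g) \<le> mass_out (sphere_deg r) g"
proof -
  obtain G x where g: "g = abs_rooted_graph (G, x)" and 1: "lf_graph G" "x \<in> verts G"
    by (rule rooted_graph_cases)
  have "(\<Sum>\<^sub>\<infinity>y\<in>verts G. ennreal (sphere_deg r (birooted_class G x y)))
      = (\<Sum>y\<in>gsphere G x r. of_nat (deg G y))"
    by (rule infsum_gsphere) (auto simp: 1 sphere_deg_birooted_class ennreal_of_nat_eq_real_of_nat)
  moreover have "(of_nat (card (gsphere G x (Suc r))) :: ennreal) \<le> of_nat (\<Sum>y\<in>gsphere G x r. deg G y)"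
    by (intro of_nat_mono card_gsphere_Suc_le 1)
  ultimately show ?thesis
    unfolding g by (simp add: 1 mass_out.abs_eq sphere_size.abs_eq rooted_iso_refl)
qed

text \<open>By symmetry of the distance, the vertices that send mass to the root \<open>x\<close>
  are those of its own sphere of radius \<open>r\<close>, and each of them sends the same amount
  \<open>deg G x\<close>.\<close>

lemma mass_in_sphere_deg: "mass_in (sphere_deg r) g = of_nat (root_deg g * sphere_size r g)"
proof -
  obtain G x where g: "g = abs_rooted_graph (G, x)" and 1: "lf_graph G" "x \<in> verts G"
    by (rule rooted_graph_cases)
  have "(\<Sum>\<^sub>\<infinity>y\<in>verts G. ennreal (sphere_deg r (birooted_class G y x)))
      = (\<Sum>y\<in>gsphere G x r. of_nat (deg G x))"
    by (rule infsum_gsphere)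
      (auto simp: 1 sphere_deg_birooted_class ennreal_of_nat_eq_real_of_nat gdist_commute[of G _ x])
  then show ?thesis
    unfolding g
    by (simp add: 1 mass_in.abs_eq root_deg.abs_eq sphere_size.abs_eq rooted_iso_refl mult.commute)
qed

lemma unimodular_sphere_size_Suc:
  assumes "unimodular M X"
  shows "(\<integral>\<^sup>+ \<omega>. of_nat (sphere_size (Suc r) (X \<omega>)) \<partial>M)
    \<le> (\<integral>\<^sup>+ \<omega>. of_nat (root_deg (X \<omega>) * sphere_size r (X \<omega>)) \<partial>M)"
proof -
  have "(\<integral>\<^sup>+ \<omega>. of_nat (sphere_size (Suc r) (X \<omega>)) \<partial>M) \<le> (\<integral>\<^sup>+ \<omega>. mass_out (sphere_deg r) (X \<omega>) \<partial>M)"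
    by (intro nn_integral_mono sphere_size_Suc_le_mass_out)
  also have "\<dots> = (\<integral>\<^sup>+ \<omega>. mass_in (sphere_deg r) (X \<omega>) \<partial>M)"
    using assms borel_measurable_sphere_deg sphere_deg_nonneg by (auto simp: unimodular_def)
  finally show ?thesis by (simp only: mass_in_sphere_deg)
qed

section \<open>Exponential bounds and the logarithm\<close>

text \<open>The tangent to the logarithm at \<open>a\<close>, used in place of Jensen's inequality.\<close>

lemma ln_le_divide_add_ln:
  fixes a b :: real
  assumes "a > 0" "b > 0"
  shows "ln b \<le> b / a + ln a"
proof -
  have "ln (b / a) \<le> b / a - 1" using assms by (intro ln_le_minus_one) simp
  then show ?thesis using assms by (simp add: ln_div)
qed

theorem lemma7p4:
  fixes M :: "'w measure" and X :: "'w \<Rightarrow> rooted_graph" and C :: real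
  assumes "random_rooted_graph M X"
    and "unimodular M X"
    and "(\<integral>\<^sup>+ \<omega>. of_nat (root_deg (X \<omega>)) \<partial>M) < \<infinity>"
    and "\<And>r. (\<integral>\<^sup>+ \<omega>. of_nat (root_deg (X \<omega>) * sphere_size r (X \<omega>)) \<partial>M)
              \<le> ennreal C * (\<integral>\<^sup>+ \<omega>. of_nat (sphere_size r (X \<omega>)) \<partial>M)"
  shows "volume_growth M X < \<infinity>"
proof -
  interpret prob_space M using assms(1) by (simp add: random_rooted_graph_def)
  have "X \<in> borel_measurable M" using assms(1) by (simp add: random_rooted_graph_def)
  then have meas_ball [measurable]: "(\<lambda>\<omega>. ball_size r (X \<omega>)) \<in> M \<rightarrow>\<^sub>M count_space UNIV" for r
    by (rule measurable_compose) (rule measurable_ball_size)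
  \<comment> \<open>Measurability of sphere sizes is inherited from that of ball sizes.\<close>
  have "sphere_size (Suc r) g = ball_size (Suc r) g - ball_size r g" for r g
    by (simp add: ball_size_Suc)
  then have meas_sphere [measurable]: "(\<lambda>\<omega>. sphere_size (Suc r) (X \<omega>)) \<in> M \<rightarrow>\<^sub>M count_space UNIV" for r
    by simp
  \<comment> \<open>Taking \<open>K\<close> at least 1 makes its powers nondecreasing and
    \<open>ln K\<close> nonnegative, and covers every real \<open>C\<close>.\<close>
  define K where "K = max 1 C"
  have K: "K \<ge> 1" "ennreal C \<le> ennreal K" by (auto simp: K_def intro: ennreal_leI)
  have sphere: "(\<integral>\<^sup>+ \<omega>. of_nat (sphere_size r (X \<omega>)) \<partial>M) \<le> ennreal (K ^ r)" for r
  proof (induction r)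
    case 0 then show ?case by (simp add: sphere_size_0 emeasure_space_1)
  next
    case (Suc r)
    have "(\<integral>\<^sup>+ \<omega>. of_nat (sphere_size (Suc r) (X \<omega>)) \<partial>M)
        \<le> ennreal C * (\<integral>\<^sup>+ \<omega>. of_nat (sphere_size r (X \<omega>)) \<partial>M)"
      using unimodular_sphere_size_Suc[OF assms(2)] assms(4) by (rule order_trans)
    also have "\<dots> \<le> ennreal K * ennreal (K ^ r)" using Suc K by (intro mult_mono) auto
    also have "\<dots> = ennreal (K ^ Suc r)" using K by (simp add: ennreal_mult)
    finally show ?case .
  qed
  \<comment> \<open>The ball consists of \<open>Suc r\<close> spheres, each of expected size at most
    \<open>K ^ r\<close> because \<open>K\<close> is at least 1.\<close>
  have ball: "(\<integral>\<^sup>+ \<omega>. of_nat (ball_size r (X \<omega>)) \<partial>M) \<le> ennreal (real (Suc r) * K ^ r)" for r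
  proof (induction r)
    case 0 then show ?case by (simp add: ball_size_0 emeasure_space_1)
  next
    case (Suc r)
    have "(\<integral>\<^sup>+ \<omega>. of_nat (ball_size (Suc r) (X \<omega>)) \<partial>M)
        = (\<integral>\<^sup>+ \<omega>. of_nat (ball_size r (X \<omega>)) \<partial>M) + (\<integral>\<^sup>+ \<omega>. of_nat (sphere_size (Suc r) (X \<omega>)) \<partial>M)"
      unfolding ball_size_Suc of_nat_add by (rule nn_integral_add) measurable
    also have "\<dots> \<le> ennreal (real (Suc r) * K ^ r) + ennreal (K ^ Suc r)"
      by (intro add_mono Suc sphere)
    also have "\<dots> = ennreal (real (Suc r) * K ^ r + K ^ Suc r)"
      using K by (intro ennreal_plus[symmetric]) auto
    also have "\<dots> \<le> ennreal (real (Suc (Suc r)) * K ^ Suc r)"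
    proof (rule ennreal_leI)
      have "K ^ r \<le> K ^ Suc r" using K by (intro power_increasing) auto
      then have "real (Suc r) * K ^ r \<le> real (Suc r) * K ^ Suc r" by (intro mult_left_mono) auto
      then show "real (Suc r) * K ^ r + K ^ Suc r \<le> real (Suc (Suc r)) * K ^ Suc r"
        by (simp add: algebra_simps)
    qed
    finally show ?case .
  qed
  have log: "inverse (of_nat r) * (\<integral>\<^sup>+ \<omega>. ennreal (ln (real (ball_size r (X \<omega>)))) \<partial>M) \<le> ennreal (2 + ln K)"
    if r: "r \<ge> 1" for r
  proof -
    \<comment> \<open>The tangent is taken at the bound for the expected ball size, so the linear
      term integrates to at most 1. Since \<open>a\<close> is at least 1, \<open>ln a\<close> is
      nonnegative and the sum can be split in \<open>ennreal\<close>.\<close>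
    define a where "a = real (Suc r) * K ^ r"
    have "K ^ r \<ge> 1" using K by simp
    then have "real (Suc r) * 1 \<le> a" unfolding a_def by (intro mult_left_mono) auto
    then have a: "a \<ge> 1" by simp
    have "(\<integral>\<^sup>+ \<omega>. ennreal (ln (real (ball_size r (X \<omega>)))) \<partial>M)
        \<le> (\<integral>\<^sup>+ \<omega>. ennreal (1 / a) * of_nat (ball_size r (X \<omega>)) + ennreal (ln a) \<partial>M)"
    proof (rule nn_integral_mono)
      fix \<omega>
      have "ln (real (ball_size r (X \<omega>))) \<le> 1 / a * real (ball_size r (X \<omega>)) + ln a"
        using ln_le_divide_add_ln[of a "real (ball_size r (X \<omega>))"] a ball_size_pos[of r "X \<omega>"] by simp
      then have "ennreal (ln (real (ball_size r (X \<omega>))))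
          \<le> ennreal (1 / a * real (ball_size r (X \<omega>)) + ln a)" by (rule ennreal_leI)
      also have "\<dots> = ennreal (1 / a) * of_nat (ball_size r (X \<omega>)) + ennreal (ln a)"
        using a unfolding ennreal_of_nat_eq_real_of_nat
        by (subst ennreal_plus) (auto simp: ennreal_mult[symmetric])
      finally show "ennreal (ln (real (ball_size r (X \<omega>))))
          \<le> ennreal (1 / a) * of_nat (ball_size r (X \<omega>)) + ennreal (ln a)" .
    qed
    also have "\<dots> = ennreal (1 / a) * (\<integral>\<^sup>+ \<omega>. of_nat (ball_size r (X \<omega>)) \<partial>M) + ennreal (ln a)"
      by (simp add: nn_integral_add nn_integral_cmult emeasure_space_1)
    also have "\<dots> \<le> ennreal (1 / a) * ennreal a + ennreal (ln a)"
      using ball[of r] unfolding a_def by (intro add_right_mono mult_left_mono) auto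
    also have "\<dots> = ennreal (1 + ln a)"
      using a by (simp add: ennreal_mult[symmetric])
    finally have int: "(\<integral>\<^sup>+ \<omega>. ennreal (ln (real (ball_size r (X \<omega>)))) \<partial>M) \<le> ennreal (1 + ln a)" .
    have "ln a = ln (real (Suc r)) + real r * ln K"
      unfolding a_def using K by (simp add: ln_mult ln_realpow)
    moreover have "ln (real (Suc r)) \<le> real r"
      using ln_le_minus_one[of "real (Suc r)"] by simp
    \<comment> \<open>The terms 1 and \<open>ln (real (Suc r))\<close> are each at most
      \<open>r\<close>, the first because \<open>r\<close> is at least 1; this is the source of the
      constant 2.\<close>
    ultimately have "1 + ln a \<le> real r * (2 + ln K)"
      using r by (simp add: algebra_simps)
    have "inverse (of_nat r) * (\<integral>\<^sup>+ \<omega>. ennreal (ln (real (ball_size r (X \<omega>)))) \<partial>M)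
        \<le> ennreal (1 / real r) * ennreal (real r * (2 + ln K))"
    proof (rule mult_mono)
      show "inverse (of_nat r) \<le> ennreal (1 / real r)"
        using r by (simp add: ennreal_of_nat_eq_real_of_nat inverse_ennreal inverse_eq_divide)
      show "(\<integral>\<^sup>+ \<omega>. ennreal (ln (real (ball_size r (X \<omega>)))) \<partial>M) \<le> ennreal (real r * (2 + ln K))"
        using int \<open>1 + ln a \<le> real r * (2 + ln K)\<close> by (meson ennreal_leI order_trans)
    qed auto
    also have "\<dots> = ennreal (2 + ln K)"
      using r K by (simp add: ennreal_mult[symmetric])
    finally show ?thesis .
  qed
  \<comment> \<open>The bound \<open>log\<close> holds from \<open>r = 1\<close> on, which is enough
    for a lower limit.\<close>
  have "volume_growth M X \<le> liminf (\<lambda>r. ennreal (2 + ln K))"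
    unfolding volume_growth_def
    by (rule Liminf_mono) (use log in \<open>auto simp: eventually_sequentially\<close>)
  also have "\<dots> < \<infinity>" by (simp add: Liminf_const)
  finally show ?thesis .
qed

end
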